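(* Suppose the polynomial $f(z)=1+\sum_{|\beta|>0}a(\beta)z^\beta\in\mathbb{C}[z_1,\ldots,z_n]$ is stable and let $$B=2^{n-1}\frac{\sqrt{2e^2-e}}{e-1},\qquad C=6e^2\Big(\sum_{i=1}^n|a(e_i)|\Big)^2+4e^2\sum_{i,j=1}^n|a(e_i+e_j)|.$$ Then $\max\{|f(z)|:|z_i|\le r,\ 1\le i\le n\}\le Be^{Cr^2}$ for all $r\ge0$.
   Context: $H=\{z\in\mathbb{C}:\Im(z)>0\}$; a polynomial is stable if it is non-zero whenever all variables lie in $H$. $e_i$ is the $i$-th standard basis vector of $\mathbb{N}^n$, $|\beta|=\sum\beta_i$, and $a(\beta)=0$ for $\beta$ not in the support of $f$. *)

theory Defs
  imports "HOL-Analysis.Analysis"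
begin

text \<open>A polynomial in n complex variables z_0,...,z_(n-1) is represented by its
coefficient function a on exponent vectors beta :: nat => nat; it must have finite
support and only involve the variables with index < n.\<close>

definition is_mpoly :: "nat \<Rightarrow> ((nat \<Rightarrow> nat) \<Rightarrow> complex) \<Rightarrow> bool" where
  "is_mpoly n a \<longleftrightarrow> finite {\<beta>. a \<beta> \<noteq> 0} \<and> (\<forall>\<beta>. a \<beta> \<noteq> 0 \<longrightarrow> (\<forall>i\<ge>n. \<beta> i = 0))"

definition mpoly_eval :: "nat \<Rightarrow> ((nat \<Rightarrow> nat) \<Rightarrow> complex) \<Rightarrow> (nat \<Rightarrow> complex) \<Rightarrow> complex" where
  "mpoly_eval n a z = (\<Sum>\<beta>\<in>{\<beta>. a \<beta> \<noteq> 0}. a \<beta> * (\<Prod>i<n. z i ^ \<beta> i))"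

definition stable :: "nat \<Rightarrow> ((nat \<Rightarrow> nat) \<Rightarrow> complex) \<Rightarrow> bool" where
  "stable n a \<longleftrightarrow> (\<forall>z. (\<forall>i<n. Im (z i) > 0) \<longrightarrow> mpoly_eval n a z \<noteq> 0)"

definition unitv :: "nat \<Rightarrow> nat \<Rightarrow> nat" where
  "unitv i = (\<lambda>j. if j = i then 1 else 0)"

end

theory Submission
  imports Defs "HOL-Complex_Analysis.Conformal_Mappings"
    "HOL-Computational_Algebra.Fundamental_Theorem_Algebra"
begin

text \<open>
  Univariate case (Szasz): write \<open>p(t) = \<Prod>(1 + c\<^sub>j t)\<close> with \<open>Im c\<^sub>j \<le> 0\<close>. Since the \<open>Im c\<^sub>j\<close> have one sign,
  \<open>\<Sum>\<bar>c\<^sub>j\<bar>\<^sup>2 = Re (\<Sum>c\<^sub>j\<^sup>2) + 2 \<Sum>(Im c\<^sub>j)\<^sup>2 \<le> \<bar>p\<^sub>1\<bar>\<^sup>2 + 2\<bar>p\<^sub>2\<bar>\<close>, which together with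
  \<open>\<bar>1 + w\<bar> \<le> exp (Re w + \<bar>w\<bar>\<^sup>2/2)\<close> bounds \<open>p\<close>. Restricting \<open>f\<close> to lines bounds it at complex
  multiples of positive vectors.

  A point \<open>z = x + iy\<close> of the polydisc is reduced to that case in two steps. First,
  \<open>\<bar>f(z)\<bar> \<le> \<bar>f(x + ir\<one>)\<bar>\<close>: the two arguments are the values at \<open>-i\<close> and \<open>i\<close> of a line whose upper
  half maps into the domain where \<open>f\<close> has no zeros. Second, \<open>x + ir\<one>\<close> is the value at \<open>w = 2i/5\<close> of
  the analytic disc \<open>w \<mapsto> (5/2) w r\<one> + (25/21)(w\<^sup>2 + 1) x\<close>, which on \<open>\<bar>w\<bar> = 1\<close> equals
  \<open>w ((5/2) r\<one> + (50/21) Re w x)\<close>, a multiple of a positive vector with entries at most \<open>5r\<close>;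
  the maximum principle applies.
\<close>

subsection \<open>Univariate polynomials without zeros in the upper half-plane\<close>

text \<open>The fundamental theorem of algebra supplies a root, necessarily in the closed lower
  half-plane, and the cofactor inherits the absence of zeros.\<close>

lemma upper_zero_free_poly_induct [consumes 1, case_names const root]:
  fixes p :: "complex poly"
  assumes "\<forall>t. Im t > 0 \<longrightarrow> poly p t \<noteq> 0"
    and const: "\<And>c. P [:c:]"
    and root: "\<And>\<zeta> q. Im \<zeta> \<le> 0 \<Longrightarrow> P q \<Longrightarrow> P ([:-\<zeta>, 1:] * q)"
  shows "P p"
  using assms(1)
proof (induction "degree p" arbitrary: p rule: less_induct)
  case less
  show ?case
  proof (cases "degree p = 0")
    case True
    then obtain c where "p = [:c:]" by (rule degree_eq_zeroE)
    then show ?thesis using const by simp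
  next
    case False
    then obtain \<zeta> where \<zeta>: "poly p \<zeta> = 0"
      using fundamental_theorem_of_algebra constant_degree by metis
    then obtain q where q: "p = [:-\<zeta>, 1:] * q"
      using poly_eq_0_iff_dvd by (metis dvdE)
    have "Im \<zeta> \<le> 0" using less.prems \<zeta> by force
    moreover have "P q"
    proof (rule less.hyps)
      have "q \<noteq> 0" using q False by auto
      then show "degree q < degree p" unfolding q by (subst degree_mult_eq) auto
      show "\<forall>t. Im t > 0 \<longrightarrow> poly q t \<noteq> 0"
        using less.prems q by auto
    qed
    ultimately show ?thesis unfolding q by (rule root)
  qed
qed

text \<open>Every root lies in the closed lower half-plane, hence no farther from -i than from i;
  multiply over the roots.\<close>

lemma cmod_poly_minus_i_le:
  fixes p :: "complex poly"
  assumes "\<forall>t. Im t > 0 \<longrightarrow> poly p t \<noteq> 0"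
  shows "cmod (poly p (- \<i>)) \<le> cmod (poly p \<i>)"
  using assms
proof (induction p rule: upper_zero_free_poly_induct)
  case (const c)
  then show ?case by simp
next
  case (root \<zeta> q)
  have "cmod (- \<i> - \<zeta>) \<le> cmod (\<i> - \<zeta>)"
    using root(1) by (auto simp: cmod_def power2_eq_square algebra_simps)
  moreover have "poly ([:-\<zeta>, 1:] * q) t = (t - \<zeta>) * poly q t" for t
    by (simp add: algebra_simps)
  ultimately show ?case using root(2) by (simp only: norm_mult mult_mono norm_ge_zero)
qed

text \<open>A root \<open>\<zeta>\<close> gives \<open>c = -1/\<zeta>\<close>, whose imaginary part
  is that of \<open>\<zeta>\<close> divided by its squared modulus, so the sign survives.\<close>

lemma upper_zero_free_poly_factors:
  fixes p :: "complex poly"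
  assumes "\<forall>t. Im t > 0 \<longrightarrow> poly p t \<noteq> 0" and "coeff p 0 \<noteq> 0"
  obtains cs where "p = smult (coeff p 0) (\<Prod>c\<leftarrow>cs. [:1, c:])" "\<forall>c\<in>set cs. Im c \<le> 0"
proof -
  have "coeff p 0 \<noteq> 0 \<longrightarrow>
    (\<exists>cs. p = smult (coeff p 0) (\<Prod>c\<leftarrow>cs. [:1, c:]) \<and> (\<forall>c\<in>set cs. Im c \<le> 0))"
    using assms(1)
  proof (induction p rule: upper_zero_free_poly_induct)
    case (const c)
    show ?case by (intro impI exI[of _ "[]"]) simp
  next
    case (root \<zeta> q)
    show ?case
    proof
      assume "coeff ([:-\<zeta>, 1:] * q) 0 \<noteq> 0"
      then have nz: "\<zeta> \<noteq> 0" "coeff q 0 \<noteq> 0" by (auto simp: coeff_mult)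
      with root obtain cs where cs: "q = smult (coeff q 0) (\<Prod>c\<leftarrow>cs. [:1, c:])"
        "\<forall>c\<in>set cs. Im c \<le> 0" by blast
      have lin: "[:-\<zeta>, 1:] = smult (-\<zeta>) [:1, -1/\<zeta>:]" using nz by simp
      have c0: "coeff ([:-\<zeta>, 1:] * q) 0 = - \<zeta> * coeff q 0" by (simp add: coeff_mult)
      have "[:-\<zeta>, 1:] * q
          = smult (-\<zeta>) [:1, -1/\<zeta>:] * smult (coeff q 0) (\<Prod>c\<leftarrow>cs. [:1, c:])"
        by (rule arg_cong2[where f = "(*)", OF lin cs(1)])
      also have "\<dots> = smult (coeff ([:-\<zeta>, 1:] * q) 0) (\<Prod>c\<leftarrow>(-1/\<zeta>) # cs. [:1, c:])"
        unfolding c0 by (simp only: mult_smult_left mult_smult_right smult_smult list.map prod_list.Cons mult.commute)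
      finally have "[:-\<zeta>, 1:] * q
        = smult (coeff ([:-\<zeta>, 1:] * q) 0) (\<Prod>c\<leftarrow>(-1/\<zeta>) # cs. [:1, c:])" .
      moreover have "Im (-1/\<zeta>) \<le> 0"
        using root(1) by (simp add: Im_divide divide_nonpos_nonneg)
      then have "\<forall>c\<in>set ((-1/\<zeta>) # cs). Im c \<le> 0" using cs(2) by simp
      ultimately show "\<exists>cs. [:-\<zeta>, 1:] * q = smult (coeff ([:-\<zeta>, 1:] * q) 0) (\<Prod>c\<leftarrow>cs. [:1, c:])
          \<and> (\<forall>c\<in>set cs. Im c \<le> 0)"
        by (intro exI[of _ "(-1/\<zeta>) # cs"] conjI)
    qed
  qed
  then show ?thesis using assms(2) that by blast
qed

text \<open>The coefficients are elementary symmetric functions of \<open>cs\<close>; the last claim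
  is Newton's identity for the second power sum.\<close>

lemma coeff_prod_linear:
  fixes cs :: "complex list"
  defines "p \<equiv> (\<Prod>c\<leftarrow>cs. [:1, c:])"
  shows "coeff p 0 = 1" and "coeff p 1 = (\<Sum>c\<leftarrow>cs. c)"
    and "(\<Sum>c\<leftarrow>cs. c ^ 2) = coeff p 1 ^ 2 - 2 * coeff p 2"
proof -
  have "coeff p 0 = 1 \<and> coeff p 1 = (\<Sum>c\<leftarrow>cs. c)
      \<and> (\<Sum>c\<leftarrow>cs. c ^ 2) = coeff p 1 ^ 2 - 2 * coeff p 2"
    unfolding p_def
    by (induction cs) (auto simp: numeral_2_eq_2 coeff_pCons power2_eq_square algebra_simps)
  then show "coeff p 0 = 1" "coeff p 1 = (\<Sum>c\<leftarrow>cs. c)"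
    "(\<Sum>c\<leftarrow>cs. c ^ 2) = coeff p 1 ^ 2 - 2 * coeff p 2" by blast+
qed

lemma cmod_one_plus_le: "cmod (1 + w) \<le> exp (Re w + cmod w ^ 2 / 2)"
proof (rule power2_le_imp_le)
  have "cmod (1 + w) ^ 2 = 1 + (2 * Re w + cmod w ^ 2)"
    unfolding cmod_power2 by (simp add: power2_eq_square algebra_simps)
  also have "\<dots> \<le> exp (2 * Re w + cmod w ^ 2)" by (rule exp_ge_add_one_self)
  also have "\<dots> = exp (Re w + cmod w ^ 2 / 2) ^ 2"
    by (simp add: exp_double[symmetric] algebra_simps)
  finally show "cmod (1 + w) ^ 2 \<le> exp (Re w + cmod w ^ 2 / 2) ^ 2" .
qed simp

text \<open>Keeping the real part in \<open>cmod_one_plus_le\<close>, rather than a modulus, makes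
  the linear terms add up to the sum of \<open>cs\<close>, which is a coefficient of the
  product.\<close>

lemma cmod_prod_linear_le:
  "cmod (poly (\<Prod>c\<leftarrow>cs. [:1, c:]) t)
    \<le> exp (Re ((\<Sum>c\<leftarrow>cs. c) * t) + (\<Sum>c\<leftarrow>cs. cmod c ^ 2) * cmod t ^ 2 / 2)"
proof (induction cs)
  case Nil
  then show ?case by simp
next
  case (Cons c cs)
  let ?E = "\<lambda>cs. Re ((\<Sum>c\<leftarrow>cs. c) * t) + (\<Sum>c\<leftarrow>cs. cmod c ^ 2) * cmod t ^ 2 / 2"
  have "cmod (poly (\<Prod>c\<leftarrow>c # cs. [:1, c:]) t)
      = cmod (1 + c * t) * cmod (poly (\<Prod>c\<leftarrow>cs. [:1, c:]) t)"
    by (simp add: norm_mult[symmetric] algebra_simps)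
  also have "\<dots> \<le> exp (Re (c * t) + cmod (c * t) ^ 2 / 2) * exp (?E cs)"
    by (intro mult_mono cmod_one_plus_le Cons.IH) auto
  also have "\<dots> = exp (?E (c # cs))"
    by (simp add: exp_add[symmetric] norm_mult power_mult_distrib field_simps)
  finally show ?case .
qed

text \<open>All cross terms in the squared sum are products of two nonpositive numbers.\<close>

lemma sum_list_squares_le:
  fixes xs :: "real list"
  assumes "\<forall>x\<in>set xs. x \<le> 0"
  shows "(\<Sum>x\<leftarrow>xs. x ^ 2) \<le> (\<Sum>x\<leftarrow>xs. x) ^ 2"
  using assms
proof (induction xs)
  case (Cons x xs)
  have "(\<Sum>x\<leftarrow>xs. x) \<le> 0" using Cons.prems by (simp add: sum_list_nonpos)
  then have "0 \<le> 2 * (x * (\<Sum>x\<leftarrow>xs. x))"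
    using Cons.prems by (simp add: mult_nonpos_nonpos)
  then show ?case using Cons by (simp add: power2_sum)
qed simp

lemma sum_list_cmod_squares_le:
  fixes cs :: "complex list"
  assumes "\<forall>c\<in>set cs. Im c \<le> 0"
  shows "(\<Sum>c\<leftarrow>cs. cmod c ^ 2)
    \<le> Re (\<Sum>c\<leftarrow>cs. c ^ 2) + 2 * (Im (\<Sum>c\<leftarrow>cs. c)) ^ 2"
proof -
  have "(\<Sum>c\<leftarrow>cs. cmod c ^ 2) = Re (\<Sum>c\<leftarrow>cs. c ^ 2) + 2 * (\<Sum>c\<leftarrow>cs. Im c ^ 2)"
    by (induction cs) (auto simp: cmod_power2 Re_power2)
  moreover have "(\<Sum>c\<leftarrow>cs. Im c ^ 2) \<le> (\<Sum>c\<leftarrow>cs. Im c) ^ 2"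
    using sum_list_squares_le[of "map Im cs"] assms by (simp add: o_def)
  moreover have "(\<Sum>c\<leftarrow>cs. Im c) = Im (\<Sum>c\<leftarrow>cs. c)"
    by (induction cs) auto
  ultimately show ?thesis by simp
qed

theorem szasz_inequality:
  fixes p :: "complex poly"
  assumes "\<forall>t. Im t > 0 \<longrightarrow> poly p t \<noteq> 0" and p0: "coeff p 0 = 1"
  shows "cmod (poly p t)
    \<le> exp (Re (coeff p 1 * t) + (cmod (coeff p 1) ^ 2 + 2 * cmod (coeff p 2)) * cmod t ^ 2 / 2)"
proof -
  obtain cs where cs: "p = (\<Prod>c\<leftarrow>cs. [:1, c:])" "\<forall>c\<in>set cs. Im c \<le> 0"
    using upper_zero_free_poly_factors[OF assms(1)] p0 by (metis one_neq_zero smult_1_left)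
  note coeffs = coeff_prod_linear[of cs, folded cs(1)]
  have "(\<Sum>c\<leftarrow>cs. cmod c ^ 2) \<le> Re (coeff p 1 ^ 2 - 2 * coeff p 2) + 2 * Im (coeff p 1) ^ 2"
    using sum_list_cmod_squares_le[OF cs(2)] unfolding coeffs(2,3)[symmetric] by (simp only: coeffs)
  \<comment> \<open>Re(s^2) + 2 (Im s)^2 = |s|^2 for s = \<open>coeff p 1\<close>.\<close>
  also have "\<dots> = cmod (coeff p 1) ^ 2 - 2 * Re (coeff p 2)"
    unfolding cmod_power2 by (simp add: power2_eq_square)
  also have "\<dots> \<le> cmod (coeff p 1) ^ 2 + 2 * cmod (coeff p 2)"
    using abs_Re_le_cmod[of "coeff p 2"] by simp
  finally have "(\<Sum>c\<leftarrow>cs. cmod c ^ 2) * cmod t ^ 2 / 2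
      \<le> (cmod (coeff p 1) ^ 2 + 2 * cmod (coeff p 2)) * cmod t ^ 2 / 2"
    by (intro divide_right_mono mult_right_mono) auto
  then show ?thesis
    using cmod_prod_linear_le[of cs t] unfolding cs(1)[symmetric] coeffs(2)[symmetric]
    by (meson add_left_mono exp_le_cancel_iff order_trans)
qed

text \<open>The linear term is absorbed by s <= 1/2 + s^2/2, at the price of a factor
  \<open>exp (1/2)\<close> that \<open>B\<close> will cover.\<close>

corollary szasz_inequality_gaussian:
  fixes p :: "complex poly"
  assumes "\<forall>t. Im t > 0 \<longrightarrow> poly p t \<noteq> 0" and "coeff p 0 = 1"
  shows "cmod (poly p t) \<le> exp (1/2 + (cmod (coeff p 1) ^ 2 + cmod (coeff p 2)) * cmod t ^ 2)"
proof -
  let ?s = "cmod (coeff p 1) * cmod t"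
  have "Re (coeff p 1 * t) \<le> ?s"
    using complex_Re_le_cmod[of "coeff p 1 * t"] by (simp add: norm_mult)
  also have "?s \<le> 1/2 + ?s ^ 2 / 2"
    using zero_le_power2[of "?s - 1"] by (simp add: power2_diff)
  finally have "Re (coeff p 1 * t) + (cmod (coeff p 1) ^ 2 + 2 * cmod (coeff p 2)) * cmod t ^ 2 / 2
      \<le> 1/2 + (cmod (coeff p 1) ^ 2 + cmod (coeff p 2)) * cmod t ^ 2"
    by (simp add: power_mult_distrib field_simps)
  then show ?thesis
    using szasz_inequality[OF assms, of t] by (meson exp_le_cancel_iff order_trans)
qed

subsection \<open>Stable polynomials along lines\<close>

lemma mpoly_eval_line_poly:
  "\<exists>p. \<forall>t. poly p t = mpoly_eval n a (\<lambda>i. u i + t * v i)"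
proof (intro exI allI)
  fix t
  show "poly (\<Sum>\<beta>\<in>{\<beta>. a \<beta> \<noteq> 0}. smult (a \<beta>) (\<Prod>i<n. [:u i, v i:] ^ \<beta> i)) t
    = mpoly_eval n a (\<lambda>i. u i + t * v i)"
    by (simp add: mpoly_eval_def poly_sum poly_prod poly_power)
qed

lemma stable_cmod_mono_Im:
  fixes x y Y :: "nat \<Rightarrow> real"
  assumes "stable n a" and bound: "\<And>i. i < n \<Longrightarrow> \<bar>y i\<bar> \<le> Y i \<and> Y i > 0"
  shows "cmod (mpoly_eval n a (\<lambda>i. Complex (x i) (y i)))
    \<le> cmod (mpoly_eval n a (\<lambda>i. Complex (x i) (Y i)))"
proof -
  \<comment> \<open>The line through the two points, parametrised so that t = -i gives height
    \<open>y\<close> and t = i gives height \<open>Y\<close>.\<close>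
  let ?u = "\<lambda>i. Complex (x i) ((Y i + y i) / 2)" and ?v = "\<lambda>i. complex_of_real ((Y i - y i) / 2)"
  obtain p where p: "\<forall>t. poly p t = mpoly_eval n a (\<lambda>i. ?u i + t * ?v i)"
    using mpoly_eval_line_poly[of n a ?u ?v] ..
  have "poly p t \<noteq> 0" if "Im t > 0" for t
  proof -
    have "Im (?u i + t * ?v i) > 0" if i: "i < n" for i
    proof (cases "Y i = y i")
      case True
      then show ?thesis using bound[OF i] by simp
    next
      case False
      then have "Im t * (Y i - y i) > 0" "Y i + y i \<ge> 0"
        using bound[OF i] \<open>Im t > 0\<close> by auto
      then show ?thesis by (simp add: add_nonneg_pos)
    qed
    then have "mpoly_eval n a (\<lambda>i. ?u i + t * ?v i) \<noteq> 0"
      by (intro \<open>stable n a\<close>[unfolded stable_def, rule_format])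
    then show ?thesis by (simp only: p not_False_eq_True)
  qed
  then have "cmod (poly p (- \<i>)) \<le> cmod (poly p \<i>)" using cmod_poly_minus_i_le by blast
  moreover have "(\<lambda>i. ?u i + (- \<i>) * ?v i) = (\<lambda>i. Complex (x i) (y i))"
    "(\<lambda>i. ?u i + \<i> * ?v i) = (\<lambda>i. Complex (x i) (Y i))"
    by (auto simp: complex_eq_iff fun_eq_iff add_divide_distrib diff_divide_distrib)
  ultimately show ?thesis by (simp only: p)
qed

section \<open>Coefficients of total degree one and two\<close>

lemma exponent_sum_1:
  fixes \<beta> :: "nat \<Rightarrow> nat"
  assumes "\<And>i. i \<ge> n \<Longrightarrow> \<beta> i = 0" and "(\<Sum>i<n. \<beta> i) = 1"
  obtains i where "i < n" "\<beta> = unitv i"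
proof -
  obtain i where i: "i < n" "\<beta> i = 1" "\<And>j. j < n \<Longrightarrow> j \<noteq> i \<Longrightarrow> \<beta> j = 0"
    using assms(2) sum_eq_1_iff[of "{..<n}" \<beta>] by auto
  have "\<beta> = unitv i"
  proof
    fix j show "\<beta> j = unitv i j"
      using i assms(1)[of j] by (cases "j < n") (auto simp: unitv_def)
  qed
  then show ?thesis using i(1) that by blast
qed

lemma exponent_sum_2:
  fixes \<beta> :: "nat \<Rightarrow> nat"
  assumes \<beta>: "\<And>i. i \<ge> n \<Longrightarrow> \<beta> i = 0" and s: "(\<Sum>i<n. \<beta> i) = 2"
  obtains i j where "i < n" "j < n" "\<beta> = (\<lambda>k. unitv i k + unitv j k)"
proof -
  obtain i where i: "i < n" "\<beta> i > 0"
    using s by (metis lessThan_iff neq0_conv sum.neutral zero_neq_numeral)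
  \<comment> \<open>Truncated subtraction is exact here because
    \<open>\<beta> i > 0\<close>.\<close>
  define \<gamma> where "\<gamma> = (\<lambda>k. \<beta> k - unitv i k)"
  have \<beta>\<gamma>: "\<beta> = (\<lambda>k. unitv i k + \<gamma> k)"
    using i by (auto simp: \<gamma>_def unitv_def)
  have "(\<Sum>k<n. unitv i k) = 1"
    using i by (simp add: unitv_def)
  then have "(\<Sum>k<n. \<gamma> k) = 1"
    using s by (subst (asm) \<beta>\<gamma>) (simp add: sum.distrib)
  moreover have "\<gamma> k = 0" if "k \<ge> n" for k using \<beta>[OF that] by (simp add: \<gamma>_def)
  ultimately obtain j where "j < n" "\<gamma> = unitv j" using exponent_sum_1[of n \<gamma>] by metis
  then show ?thesis using i(1) \<beta>\<gamma> that by blast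
qed

text \<open>Times \<open>R ^ k\<close>, this bounds the coefficient of t^k in the restriction of f
  to a ray whose direction has entries in (0, R].\<close>

definition degree_mass :: "nat \<Rightarrow> ((nat \<Rightarrow> nat) \<Rightarrow> complex) \<Rightarrow> nat \<Rightarrow> real" where
  "degree_mass n a k = (\<Sum>\<beta> | a \<beta> \<noteq> 0 \<and> (\<Sum>i<n. \<beta> i) = k. cmod (a \<beta>))"

text \<open>Only an inequality, since \<open>g\<close> may hit an exponent repeatedly, as e_i + e_j
  = e_j + e_i does.\<close>

lemma degree_mass_le_sum_image:
  assumes "finite I"
    and "\<And>\<beta>. a \<beta> \<noteq> 0 \<Longrightarrow> (\<Sum>i<n. \<beta> i) = k \<Longrightarrow> \<beta> \<in> g ` I"
  shows "degree_mass n a k \<le> (\<Sum>x\<in>I. cmod (a (g x)))"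
proof -
  have "degree_mass n a k \<le> (\<Sum>\<beta>\<in>g ` I. cmod (a \<beta>))"
    unfolding degree_mass_def using assms by (intro sum_mono2) auto
  also have "\<dots> \<le> (\<Sum>x\<in>I. cmod (a (g x)))"
    using sum_image_le[OF assms(1), of "\<lambda>\<beta>. cmod (a \<beta>)" g] by simp
  finally show ?thesis .
qed

lemma degree_mass_1_le:
  assumes "is_mpoly n a"
  shows "degree_mass n a 1 \<le> (\<Sum>i<n. cmod (a (unitv i)))"
proof (rule degree_mass_le_sum_image)
  fix \<beta> assume "a \<beta> \<noteq> 0" "(\<Sum>i<n. \<beta> i) = 1"
  moreover have "\<And>i. i \<ge> n \<Longrightarrow> \<beta> i = 0"
    using assms \<open>a \<beta> \<noteq> 0\<close> by (auto simp: is_mpoly_def)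
  ultimately show "\<beta> \<in> unitv ` {..<n}"
    using exponent_sum_1[of n \<beta>] by (metis imageI lessThan_iff)
qed simp

lemma degree_mass_2_le:
  assumes "is_mpoly n a"
  shows "degree_mass n a 2 \<le> (\<Sum>i<n. \<Sum>j<n. cmod (a (\<lambda>k. unitv i k + unitv j k)))"
proof -
  have "degree_mass n a 2
      \<le> (\<Sum>x\<in>{..<n} \<times> {..<n}. cmod (a ((\<lambda>(i, j) k. unitv i k + unitv j k) x)))"
  proof (rule degree_mass_le_sum_image)
    fix \<beta> assume *: "a \<beta> \<noteq> 0" "(\<Sum>i<n. \<beta> i) = 2"
    have "\<And>i. i \<ge> n \<Longrightarrow> \<beta> i = 0"
      using assms *(1) by (auto simp: is_mpoly_def)
    then obtain i j where "i < n" "j < n" "\<beta> = (\<lambda>k. unitv i k + unitv j k)"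
      using exponent_sum_2[of n \<beta>] *(2) by metis
    then show "\<beta> \<in> (\<lambda>(i, j) k. unitv i k + unitv j k) ` ({..<n} \<times> {..<n})"
      by (intro image_eqI[of _ _ "(i, j)"]) auto
  qed simp
  then show ?thesis by (simp add: sum.cartesian_product case_prod_unfold)
qed

section \<open>Growth along positive rays and on the polydisc\<close>

text \<open>For positive \<open>v\<close> the map t -> tv sends H into H^n, so the restriction has
  no zeros in H and the univariate bound applies.\<close>

lemma cmod_stable_positive_ray_le:
  fixes v :: "nat \<Rightarrow> real"
  assumes mp: "is_mpoly n a" and a0: "a (\<lambda>_. 0) = 1" and st: "stable n a"
    and v: "\<And>i. i < n \<Longrightarrow> 0 < v i \<and> v i \<le> R"
  shows "cmod (mpoly_eval n a (\<lambda>i. t * of_real (v i)))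
    \<le> exp (1/2 + (degree_mass n a 1 ^ 2 + degree_mass n a 2) * R ^ 2 * cmod t ^ 2)"
proof -
  have fin: "finite {\<beta>. a \<beta> \<noteq> 0}" using mp by (simp add: is_mpoly_def)
  \<comment> \<open>Monomials enter by total degree, so that coefficients of the restriction can be
    read off.\<close>
  define p where "p = (\<Sum>\<beta>\<in>{\<beta>. a \<beta> \<noteq> 0}.
    monom (a \<beta> * (\<Prod>i<n. of_real (v i) ^ \<beta> i)) (\<Sum>i<n. \<beta> i))"
  have eval: "poly p t = mpoly_eval n a (\<lambda>i. t * of_real (v i))" for t
    unfolding p_def mpoly_eval_def
    by (simp add: poly_sum poly_monom power_mult_distrib prod.distrib power_sum mult_ac)
  have coeff: "coeff p k
      = (\<Sum>\<beta> | a \<beta> \<noteq> 0 \<and> (\<Sum>i<n. \<beta> i) = k. a \<beta> * (\<Prod>i<n. of_real (v i) ^ \<beta> i))" for k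
  proof -
    have "coeff p k = (\<Sum>\<beta>\<in>{\<beta>. a \<beta> \<noteq> 0}.
        if (\<Sum>i<n. \<beta> i) = k then a \<beta> * (\<Prod>i<n. of_real (v i) ^ \<beta> i) else 0)"
      unfolding p_def by (simp add: coeff_sum)
    also have "\<dots> = (\<Sum>\<beta> | a \<beta> \<noteq> 0 \<and> (\<Sum>i<n. \<beta> i) = k. a \<beta> * (\<Prod>i<n. of_real (v i) ^ \<beta> i))"
      by (simp add: sum.inter_filter[OF fin, symmetric])
    finally show ?thesis .
  qed
  have coeff_le: "cmod (coeff p k) \<le> degree_mass n a k * R ^ k" for k
  proof -
    have "cmod (a \<beta> * (\<Prod>i<n. of_real (v i) ^ \<beta> i)) \<le> cmod (a \<beta>) * R ^ k"
      if "(\<Sum>i<n. \<beta> i) = k" for \<beta>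
    proof -
      have "cmod (\<Prod>i<n. of_real (v i) ^ \<beta> i) = (\<Prod>i<n. v i ^ \<beta> i)"
        using v by (auto simp: prod_norm[symmetric] norm_power less_imp_le intro!: prod.cong)
      also have "\<dots> \<le> (\<Prod>i<n. R ^ \<beta> i)"
        using v by (intro prod_mono) (auto intro!: power_mono simp: less_imp_le)
      also have "\<dots> = R ^ k" using that by (simp add: power_sum[symmetric])
      finally show ?thesis by (simp add: norm_mult mult_left_mono)
    qed
    then show ?thesis
      unfolding coeff degree_mass_def sum_distrib_right by (intro sum_norm_le) auto
  qed
  have "{\<beta>. a \<beta> \<noteq> 0 \<and> (\<Sum>i<n. \<beta> i) = 0} = {\<lambda>_. 0}"
  proof -
    have "\<beta> = (\<lambda>_. 0)" if "a \<beta> \<noteq> 0" "(\<Sum>i<n. \<beta> i) = 0" for \<beta>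
    proof
      fix i show "\<beta> i = 0"
        using that mp by (cases "i < n") (auto simp: is_mpoly_def)
    qed
    then show ?thesis using a0 by auto
  qed
  then have "coeff p 0 = 1" by (simp add: coeff a0)
  moreover have "poly p s \<noteq> 0" if "Im s > 0" for s
    using st v that by (auto simp: eval stable_def)
  ultimately have "cmod (poly p t) \<le> exp (1/2 + (cmod (coeff p 1) ^ 2 + cmod (coeff p 2)) * cmod t ^ 2)"
    using szasz_inequality_gaussian by blast
  also have "\<dots> \<le> exp (1/2 + ((degree_mass n a 1 * R ^ 1) ^ 2 + degree_mass n a 2 * R ^ 2) * cmod t ^ 2)"
    unfolding exp_le_cancel_iff
    by (intro add_left_mono mult_right_mono add_mono power_mono coeff_le) auto
  finally show ?thesis by (simp add: eval power_mult_distrib algebra_simps)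
qed

lemma cmod_stable_le:
  assumes mp: "is_mpoly n a" and a0: "a (\<lambda>_. 0) = 1" and st: "stable n a"
    and r: "r > 0" and z: "\<And>i. i < n \<Longrightarrow> cmod (z i) \<le> r"
  shows "cmod (mpoly_eval n a z)
    \<le> exp (1/2 + (degree_mass n a 1 ^ 2 + degree_mass n a 2) * (5 * r) ^ 2)"
    (is "_ \<le> ?E")
proof -
  define x where "x = (\<lambda>i. Re (z i))"
  have x: "\<bar>x i\<bar> \<le> r" if "i < n" for i
    using z[OF that] abs_Re_le_cmod[of "z i"] by (simp add: x_def)
  have "cmod (mpoly_eval n a z) = cmod (mpoly_eval n a (\<lambda>i. Complex (x i) (Im (z i))))"
    by (simp add: x_def)
  also have "\<dots> \<le> cmod (mpoly_eval n a (\<lambda>i. Complex (x i) r))"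
  proof (rule stable_cmod_mono_Im[OF st])
    show "\<bar>Im (z i)\<bar> \<le> r \<and> r > 0" if "i < n" for i
      using z[OF that] abs_Im_le_cmod[of "z i"] r by simp
  qed
  also have "\<dots> \<le> ?E"
  proof -
    \<comment> \<open>At w = 2i/5 the first term is ir, and w^2 + 1 = 21/25 cancels the factor
      25/21.\<close>
    define D where "D = (\<lambda>w i. 5/2 * of_real r * w + 25/21 * (w ^ 2 + 1) * complex_of_real (x i))"
    define F where "F = (\<lambda>w. mpoly_eval n a (D w))"
    have hol: "F holomorphic_on UNIV"
      unfolding F_def D_def mpoly_eval_def by (intro holomorphic_intros)
    have "cmod (F (2/5 * \<i>)) \<le> ?E"
    proof (rule maximum_modulus_frontier[where f = F and S = "cball 0 1"])
      show "F holomorphic_on interior (cball 0 1)" "continuous_on (closure (cball 0 1)) F"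
        using hol holomorphic_on_subset holomorphic_on_imp_continuous_on by blast+
    next
      fix w :: complex assume "w \<in> frontier (cball 0 1)"
      then have w: "cmod w = 1" by (simp add: dist_norm)
      \<comment> \<open>On the unit circle \<open>w * cnj w = 1\<close>.\<close>
      have "w ^ 2 + 1 = w * (w + cnj w)"
        using complex_norm_square[of w] w by (simp add: power2_eq_square algebra_simps)
      then have w2: "w ^ 2 + 1 = w * of_real (2 * Re w)" by (simp add: complex_add_cnj)
      define v where "v = (\<lambda>i. 5/2 * r + 50/21 * Re w * x i)"
      have "D w = (\<lambda>i. w * of_real (v i))"
        unfolding D_def w2 v_def by (auto simp: algebra_simps)
      \<comment> \<open>Positivity and the bound both come from 50/21 < 5/2.\<close>
      moreover have "0 < v i \<and> v i \<le> 5 * r" if "i < n" for i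
      proof -
        have "\<bar>Re w * x i\<bar> \<le> 1 * r"
          unfolding abs_mult using x[OF that] abs_Re_le_cmod[of w] w by (intro mult_mono) auto
        then show ?thesis using r by (auto simp: v_def abs_le_iff)
      qed
      ultimately show "cmod (F w) \<le> ?E"
        using cmod_stable_positive_ray_le[OF mp a0 st, of v "5 * r" w] w by (simp add: F_def)
    qed (auto simp: norm_mult)
    moreover have "D (2/5 * \<i>) = (\<lambda>i. Complex (x i) r)"
      by (auto simp: D_def complex_eq_iff power_mult_distrib power2_eq_square)
    ultimately show ?thesis by (simp add: F_def)
  qed
  finally show ?thesis .
qed

section \<open>Comparison with the constants \<open>B\<close> and \<open>C\<close>\<close>

theorem theorem5p5:
  fixes n :: nat and a :: "(nat \<Rightarrow> nat) \<Rightarrow> complex"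
  assumes "is_mpoly n a"
    and "a (\<lambda>_. 0) = 1"
    and "stable n a"
    and "r \<ge> (0::real)"
  defines "B \<equiv> 2 ^ (n - 1) * sqrt (2 * exp 1 ^ 2 - exp 1) / (exp 1 - 1)"
    and "C \<equiv> 6 * exp 1 ^ 2 * (\<Sum>i<n. cmod (a (unitv i))) ^ 2
              + 4 * exp 1 ^ 2 * (\<Sum>i<n. \<Sum>j<n. cmod (a (\<lambda>k. unitv i k + unitv j k)))"
  shows "\<forall>z. (\<forall>i<n. cmod (z i) \<le> r) \<longrightarrow> cmod (mpoly_eval n a z) \<le> B * exp (C * r ^ 2)"
proof (intro allI impI)
  fix z assume z: "\<forall>i<n. cmod (z i) \<le> r"
  define A1 where "A1 = (\<Sum>i<n. cmod (a (unitv i)))"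
  define A2 where "A2 = (\<Sum>i<n. \<Sum>j<n. cmod (a (\<lambda>k. unitv i k + unitv j k)))"
  have nonneg: "A1 \<ge> 0" "A2 \<ge> 0" by (auto simp: A1_def A2_def intro!: sum_nonneg)
  have e: "5/2 \<le> exp (1::real)" "exp (1::real) < 3"
    using exp_lower_Taylor_quadratic[of "1::real"] e_less_272 by auto
  \<comment> \<open>After squaring, the case of factor 1 in place of the power of 2 reads (e - 1)^2
    <= 2e - 1, which follows from (e - 2)^2 <= 1. The power of 2 is at least 1; for
    \<open>n = 0\<close> its truncated exponent is 0.\<close>
  have B: "exp (1/2) \<le> B"
  proof -
    have "(exp 1 - 2) ^ 2 \<le> (1::real) ^ 2" using e by (intro power_mono) auto
    then have "exp 1 * (exp 1 - 1) ^ 2 \<le> exp 1 * (2 * exp 1 - (1::real))"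
      by (intro mult_left_mono) (auto simp: power2_diff)
    moreover have half: "exp (1/2) ^ 2 = (exp 1 :: real)"
      using exp_double[of "1/2 :: real"] by simp
    ultimately have "(exp (1/2) * (exp 1 - 1)) ^ 2 \<le> 2 * exp 1 ^ 2 - (exp 1 :: real)"
      unfolding power_mult_distrib half by (simp add: power2_eq_square[of "exp 1"] right_diff_distrib)
    then have "exp (1/2) * (exp 1 - 1) \<le> sqrt (2 * exp 1 ^ 2 - (exp 1 :: real))"
      by (rule real_le_rsqrt)
    then have "exp (1/2) \<le> sqrt (2 * exp 1 ^ 2 - exp 1) / (exp 1 - (1::real))"
      using e by (simp add: pos_le_divide_eq)
    also have "\<dots> \<le> 2 ^ (n - 1) * (sqrt (2 * exp 1 ^ 2 - exp 1) / (exp 1 - 1))"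
    proof -
      have "0 \<le> sqrt (2 * exp 1 ^ 2 - exp 1) / (exp 1 - (1::real))"
        using calculation by (meson exp_ge_zero order_trans)
      moreover have "1 \<le> (2::real) ^ (n - 1)" by simp
      ultimately show ?thesis by (metis mult_1_left mult_right_mono)
    qed
    finally show ?thesis by (simp add: B_def)
  qed
  \<comment> \<open>The 25 is the square of the 5 in the ray bound \<open>5 * r\<close>; it is at
    most 4e^2 because e >= 5/2.\<close>
  have C: "(A1 ^ 2 + A2) * 25 \<le> C"
  proof -
    have "(5/2) ^ 2 \<le> exp (1::real) ^ 2" using e by (intro power_mono) auto
    then have "25 \<le> 6 * exp (1::real) ^ 2" "25 \<le> 4 * exp (1::real) ^ 2"
      by (auto simp: power2_eq_square)
    then have "25 * A1 ^ 2 + 25 * A2 \<le> 6 * exp 1 ^ 2 * A1 ^ 2 + 4 * exp 1 ^ 2 * A2"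
      using nonneg by (intro add_mono mult_right_mono) auto
    then show ?thesis by (simp add: C_def A1_def A2_def algebra_simps)
  qed
  show "cmod (mpoly_eval n a z) \<le> B * exp (C * r ^ 2)"
  proof (cases "r = 0")
    case True
    \<comment> \<open>\<open>cmod_stable_le\<close> requires \<open>r > 0\<close>. At
      \<open>r = 0\<close> the first \<open>n\<close> coordinates vanish, and the ray bound at
      parameter 0 suffices.\<close>
    have "mpoly_eval n a z = mpoly_eval n a (\<lambda>i. 0 * of_real 1)"
      using z True unfolding mpoly_eval_def by (intro sum.cong arg_cong2[where f = "(*)"] prod.cong) auto
    also have "cmod \<dots> \<le> exp (1/2)"
      using cmod_stable_positive_ray_le[OF assms(1-3), of "\<lambda>_. 1" 1 0] by simp
    finally have "cmod (mpoly_eval n a z) \<le> exp (1/2)" .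
    then show ?thesis using B True by simp
  next
    case False
    have mass: "degree_mass n a 1 ^ 2 + degree_mass n a 2 \<le> A1 ^ 2 + A2"
      using degree_mass_1_le[OF assms(1)] degree_mass_2_le[OF assms(1)]
      unfolding A1_def A2_def
      by (intro add_mono power_mono) (auto simp: degree_mass_def intro!: sum_nonneg)
    have "(degree_mass n a 1 ^ 2 + degree_mass n a 2) * (5 * r) ^ 2 \<le> (A1 ^ 2 + A2) * (5 * r) ^ 2"
      by (intro mult_right_mono mass) simp
    also have "\<dots> = (A1 ^ 2 + A2) * 25 * r ^ 2" by (simp add: power_mult_distrib)
    also have "\<dots> \<le> C * r ^ 2" by (intro mult_right_mono C) simp
    finally have "exp (1/2 + (degree_mass n a 1 ^ 2 + degree_mass n a 2) * (5 * r) ^ 2)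
        \<le> exp (1/2) * exp (C * r ^ 2)"
      by (simp add: exp_add[symmetric])
    also have "\<dots> \<le> B * exp (C * r ^ 2)" by (intro mult_right_mono B) simp
    finally show ?thesis
      using cmod_stable_le[OF assms(1-3), of r z] z False assms(4) by force
  qed
qed

end
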